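(* Let $N\subset\mathbb{R}^d$ with $d\geq 1$. Suppose that for every $x\in N$ $$\liminf_{r\to 0}\frac{\int_r^{1}d_N^2(x,t)\,\frac{dt}{t}}{-\log r}\leq d_0^2 .$$ Then $$\dim_H(N)\leq c\,d_0^2,$$ where $c$ is a universal constant.
   Context: $\dim_H$ is the Hausdorff dimension and $d_0$ is a real number. For $N\subset\mathbb{R}^d$, $x\in N$ and $r>0$, the convex density of $N$ at $x$ at the scale $r$ is $$d_N(x,r)=\frac{I(x,r)}{2r},$$ where $I(x,r)$ is the diameter of the convex hull of $N\cap B(x,r)$, and $B(x,r)$ is the ball of center $x$ and radius $r$.
   Formalization: The constant c may depend on the dimension d (but not on N or d_0); a c independent of d is impossible, since N = R^d satisfies the hypothesis with d_0 = 1 and has dimension d. *)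

theory Defs
  imports "HOL-Analysis.Analysis"
begin

definition convex_density :: "'a::euclidean_space set \<Rightarrow> 'a \<Rightarrow> real \<Rightarrow> real" where
  "convex_density N x r = diameter (convex hull (N \<inter> ball x r)) / (2 * r)"

text \<open>
  The term \<open>diam(U)\<^sup>s\<close>, with \<open>diam({})\<^sup>0 = 0\<close> and \<open>diam(U)\<^sup>0 = 1\<close> for nonempty \<open>U\<close>
  (whereas \<open>0 powr 0 = 0\<close> in the library), so that the measure for \<open>s = 0\<close> is the counting measure.
\<close>

definition hausdorff_gauge :: "real \<Rightarrow> 'a::metric_space set \<Rightarrow> real" where
  "hausdorff_gauge s U =
     (if U = {} then 0 else if s = 0 then 1 else diameter U powr s)"

text \<open>
  Boundedness of the covering sets is required explicitly, since \<open>diameter\<close> is real-valued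
  and has no meaningful value on unbounded sets.
\<close>

definition hausdorff_content :: "real \<Rightarrow> real \<Rightarrow> 'a::metric_space set \<Rightarrow> ennreal" where
  "hausdorff_content s \<delta> A =
     (INF U \<in> {U :: nat \<Rightarrow> 'a set. A \<subseteq> (\<Union>i. U i) \<and> (\<forall>i. bounded (U i) \<and> diameter (U i) \<le> \<delta>)}.
        \<Sum>i. ennreal (hausdorff_gauge s (U i)))"

definition hausdorff_measure :: "real \<Rightarrow> 'a::metric_space set \<Rightarrow> ennreal" where
  "hausdorff_measure s A = (SUP \<delta> \<in> {0<..}. hausdorff_content s \<delta> A)"

definition hausdorff_dim :: "'a::metric_space set \<Rightarrow> ereal" where
  "hausdorff_dim A = Inf {ereal s | s. 0 \<le> s \<and> hausdorff_measure s A = 0}"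

end

theory Submission
  imports Defs
begin

text \<open>
  Call \<open>2\<^sup>-\<^sup>k\<close> a bad scale at \<open>x\<close> when \<open>N \<inter> B(x, 2\<^sup>-\<^sup>k)\<close> has diameter at least \<open>2\<^sup>-\<^sup>k / 4\<close>.  Each bad
  scale contributes at least a constant to the integral, so at every \<open>x\<close> there are infinitely many
  \<open>n\<close> with at most \<open>C d\<^sub>0\<^sup>2 n\<close> bad scales among the first \<open>n\<close>.  For fixed \<open>n\<close> such points are covered
  by \<open>K\<close> to the power \<open>C d\<^sub>0\<^sup>2 n\<close> sets of diameter \<open>2\<^sup>-\<^sup>n\<close>, because only bad scales force a set to be
  split, and then into at most \<open>K\<close> pieces.  Summing over large \<open>n\<close>, as in the Borel-Cantelli lemma,
  gives a null set in every dimension above \<open>C log\<^sub>2 K d\<^sub>0\<^sup>2\<close>.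
\<close>

section \<open>Hausdorff content\<close>

lemma hausdorff_content_le_cover:
  assumes "A \<subseteq> (\<Union>i. U i)" and "\<And>i. bounded (U i)" and "\<And>i. diameter (U i) \<le> \<delta>"
  shows "hausdorff_content s \<delta> A \<le> (\<Sum>i. ennreal (hausdorff_gauge s (U i)))"
  unfolding hausdorff_content_def by (rule INF_lower) (use assms in auto)

lemma hausdorff_content_mono:
  assumes "A \<subseteq> B"
  shows "hausdorff_content s \<delta> A \<le> hausdorff_content s \<delta> B"
  unfolding hausdorff_content_def by (rule INF_superset_mono) (use assms in auto)

lemma hausdorff_content_finite_cover:
  fixes A :: "'a::metric_space set"
  assumes "0 < s" "0 \<le> D" "D \<le> \<delta>" "finite \<U>" "A \<subseteq> \<Union>\<U>"
    and \<U>: "\<And>U. U \<in> \<U> \<Longrightarrow> bounded U \<and> diameter U \<le> D"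
  shows "hausdorff_content s \<delta> A \<le> ennreal (real (card \<U>) * D powr s)"
proof -
  obtain f where f: "bij_betw f {..<card \<U>} \<U>"
    using bij_betw_from_nat_into_finite[OF \<open>finite \<U>\<close>] by blast
  \<comment> \<open>Padding by empty sets costs nothing, since the gauge of \<open>{}\<close> is 0
    for every exponent; the series becomes a finite sum.\<close>
  define U where "U i = (if i < card \<U> then f i else {})" for i
  have mem: "f i \<in> \<U>" if "i < card \<U>" for i
    using f that by (auto simp: bij_betw_def)
  have "A \<subseteq> (\<Union>i. U i)"
  proof
    fix x assume "x \<in> A"
    then obtain V where "V \<in> \<U>" "x \<in> V" using assms by blast
    then obtain i where "i < card \<U>" "f i = V"
      using f by (metis bij_betw_iff_bijections lessThan_iff)
    then show "x \<in> (\<Union>i. U i)" using \<open>x \<in> V\<close> by (auto simp: U_def intro!: exI[of _ i])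
  qed
  moreover have "bounded (U i)" "diameter (U i) \<le> \<delta>" for i
    using mem[of i] \<U>[of "f i"] assms(2,3) by (auto simp: U_def)
  ultimately have "hausdorff_content s \<delta> A \<le> (\<Sum>i. ennreal (hausdorff_gauge s (U i)))"
    by (intro hausdorff_content_le_cover)
  also have "\<dots> = (\<Sum>i<card \<U>. ennreal (hausdorff_gauge s (U i)))"
    by (rule suminf_finite) (auto simp: U_def hausdorff_gauge_def)
  also have "\<dots> \<le> (\<Sum>i<card \<U>. ennreal (D powr s))"
  proof (rule sum_mono)
    fix i assume "i \<in> {..<card \<U>}"
    then have "U i \<in> \<U>" using mem by (simp add: U_def)
    then have "diameter (U i) powr s \<le> D powr s"
      using \<U>[of "U i"] \<open>0 < s\<close> by (intro powr_mono2) (auto intro: diameter_ge_0)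
    then show "ennreal (hausdorff_gauge s (U i)) \<le> ennreal (D powr s)"
      using \<open>0 < s\<close> by (auto simp: hausdorff_gauge_def intro!: ennreal_leI)
  qed
  also have "\<dots> = ennreal (real (card \<U>) * D powr s)"
    by (simp add: ennreal_mult ennreal_of_nat_eq_real_of_nat)
  finally show ?thesis .
qed

text \<open>Near-optimal covers of the sets \<open>A n\<close>, with errors that add up to
  \<open>e\<close>, are merged into one sequence by the pairing of indices. All of them respect the
  same \<delta>, so the argument works for the content at a fixed scale.\<close>

lemma hausdorff_content_countable_subadditive:
  fixes A :: "nat \<Rightarrow> 'a::metric_space set"
  shows "hausdorff_content s \<delta> (\<Union>n. A n) \<le> (\<Sum>n. hausdorff_content s \<delta> (A n))"
proof (rule ennreal_le_epsilon)
  fix e :: real assume fin: "(\<Sum>n. hausdorff_content s \<delta> (A n)) < top" and "0 < e"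
  define \<epsilon> where "\<epsilon> n = e * (1/2)^Suc n" for n
  have \<epsilon>: "0 < \<epsilon> n" for n using \<open>0 < e\<close> by (simp add: \<epsilon>_def)
  have "\<exists>U. A n \<subseteq> (\<Union>i. U i) \<and> (\<forall>i. bounded (U i) \<and> diameter (U i) \<le> \<delta>) \<and>
     (\<Sum>i. ennreal (hausdorff_gauge s (U i))) < hausdorff_content s \<delta> (A n) + ennreal (\<epsilon> n)" for n
  proof -
    \<comment> \<open>Finiteness makes adding a positive error strictly increase the content; the
      infimum then yields a cover below the larger value.\<close>
    have "hausdorff_content s \<delta> (A n) < top"
      using fin ennreal_suminf_lessD by blast
    then have "hausdorff_content s \<delta> (A n) < hausdorff_content s \<delta> (A n) + ennreal (\<epsilon> n)"
      using \<epsilon>[of n] by (simp add: ennreal_less_zero_iff)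
    then show ?thesis
      by (subst (asm) hausdorff_content_def) (auto simp: INF_less_iff)
  qed
  then obtain U where U: "\<And>n. A n \<subseteq> (\<Union>i. U n i)"
      "\<And>n i. bounded (U n i)" "\<And>n i. diameter (U n i) \<le> \<delta>"
      "\<And>n. (\<Sum>i. ennreal (hausdorff_gauge s (U n i))) < hausdorff_content s \<delta> (A n) + ennreal (\<epsilon> n)"
    by metis
  define V where "V k = case_prod U (prod_decode k)" for k
  have "(\<Union>n. A n) \<subseteq> (\<Union>k. V k)"
  proof
    fix x assume "x \<in> (\<Union>n. A n)"
    then obtain n i where "x \<in> U n i" using U(1) by blast
    then have "x \<in> V (prod_encode (n, i))" by (simp add: V_def)
    then show "x \<in> (\<Union>k. V k)" by blast
  qed
  then have "hausdorff_content s \<delta> (\<Union>n. A n) \<le> (\<Sum>k. ennreal (hausdorff_gauge s (V k)))"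
    by (rule hausdorff_content_le_cover) (use U in \<open>auto simp: V_def split: prod.split\<close>)
  also have "\<dots> = (\<Sum>k. (\<lambda>(n, i). ennreal (hausdorff_gauge s (U n i))) (prod_decode k))"
    by (simp add: V_def split_beta)
  also have "\<dots> = (\<Sum>n. \<Sum>i. ennreal (hausdorff_gauge s (U n i)))"
    by (rule suminf_ennreal_2dimen) simp
  also have "\<dots> \<le> (\<Sum>n. hausdorff_content s \<delta> (A n) + ennreal (\<epsilon> n))"
    using U(4) by (intro suminf_le) (auto intro: less_imp_le)
  also have "\<dots> = (\<Sum>n. hausdorff_content s \<delta> (A n)) + (\<Sum>n. ennreal (\<epsilon> n))"
    by (rule suminf_add[symmetric]) auto
  also have "(\<Sum>n. ennreal (\<epsilon> n)) = ennreal e"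
  proof (rule suminf_ennreal_eq)
    show "\<epsilon> sums e" unfolding \<epsilon>_def using sums_mult[OF power_half_series, of e] by simp
  qed (use \<epsilon> in \<open>auto intro: less_imp_le\<close>)
  finally show "hausdorff_content s \<delta> (\<Union>n. A n) \<le> (\<Sum>n. hausdorff_content s \<delta> (A n)) + ennreal e" .
qed

text \<open>Every exponent \<open>b + e\<close> with \<open>0 < e\<close> belongs to the set whose
  infimum is the dimension. The exponent \<open>b\<close> may fail to belong to it, hence the
  passage through \<open>e\<close>.\<close>

lemma hausdorff_dim_le:
  assumes "0 \<le> b" and "\<And>s \<delta>. b < s \<Longrightarrow> 0 < \<delta> \<Longrightarrow> hausdorff_content s \<delta> A = 0"
  shows "hausdorff_dim A \<le> ereal b"
proof (rule ereal_le_epsilon2)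
  fix e :: real assume "0 < e"
  have "hausdorff_measure (b + e) A = 0"
    unfolding hausdorff_measure_def using assms(2)[of "b + e"] \<open>0 < e\<close> by (auto simp: SUP_eq_iff)
  then show "hausdorff_dim A \<le> ereal b + ereal e"
    unfolding hausdorff_dim_def using \<open>0 \<le> b\<close> \<open>0 < e\<close> by (intro Inf_lower) auto
qed

section \<open>Good and bad scales\<close>

text \<open>The threshold is fitted to the covering induction, which keeps diameters at most
  \<open>(1/2)^k / 2\<close> at level \<open>k\<close>: a good scale gives a bound below
  \<open>(1/2)^k / 4\<close>, which is the bound required at level \<open>Suc k\<close>. The hull is
  that of the convex density, so a bad scale bounds the density from below.\<close>

definition bad_scale :: "'a::euclidean_space set \<Rightarrow> 'a \<Rightarrow> nat \<Rightarrow> bool" where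
  "bad_scale N x k \<longleftrightarrow> (1/2)^k / 4 \<le> diameter (convex hull (N \<inter> ball x ((1/2)^k)))"

text \<open>By compactness finitely many balls of radius 1/4 cover the closed unit ball. A set of
  diameter at most \<open>D\<close> lies in the closed ball of radius \<open>D\<close> about any of
  its points, so scaled and translated copies of these balls cut it into pieces of diameter at most
  \<open>D / 2\<close>. Thus \<open>K\<close> depends on the space only.\<close>

lemma halving_cover:
  "\<exists>K::nat. 2 \<le> K \<and> (\<forall>(A::'a::euclidean_space set) D. 0 < D \<and> bounded A \<and> diameter A \<le> D \<longrightarrow>
     (\<exists>\<U>. finite \<U> \<and> card \<U> \<le> K \<and> A = \<Union>\<U> \<and> (\<forall>U\<in>\<U>. bounded U \<and> diameter U \<le> D / 2)))"
proof -
  obtain F where F: "finite F" "cball (0::'a) 1 \<subseteq> (\<Union>y\<in>F. ball y (1/4))"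
  proof -
    have "cball (0::'a) 1 \<subseteq> (\<Union>y\<in>cball 0 1. ball y (1/4))"
      by (rule subsetI) (rule UN_I, assumption, simp)
    then show ?thesis
      by (rule compactE_image[OF compact_cball open_ball]) (rule that)
  qed
  show ?thesis
  \<comment> \<open>The surplus 2 gives \<open>2 \<le> K\<close> without an estimate of
    \<open>card F\<close>, so that \<open>log 2 K\<close> is positive later.\<close>
  proof (intro exI[of _ "card F + 2"] conjI allI impI)
    fix A :: "'a set" and D :: real
    assume A: "0 < D \<and> bounded A \<and> diameter A \<le> D"
    show "\<exists>\<U>. finite \<U> \<and> card \<U> \<le> card F + 2 \<and> A = \<Union>\<U> \<and> (\<forall>U\<in>\<U>. bounded U \<and> diameter U \<le> D / 2)"
    proof (cases "A = {}")
      case True then show ?thesis by (intro exI[of _ "{}"]) auto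
    next
      case False
      then obtain a where a: "a \<in> A" by blast
      define P where "P y = A \<inter> ball (a + D *\<^sub>R y) (D/4)" for y
      have "A \<subseteq> \<Union>(P ` F)"
      proof
        fix x assume x: "x \<in> A"
        have "dist a x \<le> D" using diameter_bounded_bound[of A a x] A a x by simp
        then have "(x - a) /\<^sub>R D \<in> cball 0 1"
          using A by (simp add: dist_norm norm_minus_commute inverse_eq_divide pos_divide_le_eq)
        then obtain y where y: "y \<in> F" "dist y ((x - a) /\<^sub>R D) < 1/4"
          using F(2) unfolding subset_iff UN_iff mem_ball by blast
        have "a + D *\<^sub>R y - x = D *\<^sub>R (y - (x - a) /\<^sub>R D)"
          using A by (simp add: algebra_simps)
        then have "dist (a + D *\<^sub>R y) x = D * dist y ((x - a) /\<^sub>R D)"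
          using A by (simp add: dist_norm)
        also have "\<dots> < D / 4" using mult_strict_left_mono[OF y(2), of D] A by simp
        finally show "x \<in> \<Union>(P ` F)" using x y by (auto simp: P_def)
      qed
      moreover have "bounded (P y) \<and> diameter (P y) \<le> D / 2" for y
      proof
        show "bounded (P y)" by (simp add: P_def bounded_Int)
        have "diameter (P y) \<le> diameter (ball (a + D *\<^sub>R y) (D/4))"
          by (rule diameter_subset) (auto simp: P_def)
        then show "diameter (P y) \<le> D / 2" using A by (simp split: if_splits)
      qed
      moreover have "card (P ` F) \<le> card F + 2" using card_image_le[OF F(1), of P] by simp
      ultimately show ?thesis using F(1) by (intro exI[of _ "P ` F"]) (auto simp: P_def)
    qed
  qed auto
qed

text \<open>
  If some point of \<open>A\<close> has a good scale \<open>2\<^sup>-\<^sup>k\<close>, then \<open>A\<close> already has half the expected diameter and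
  need not be split; otherwise \<open>k\<close> is bad for all of \<open>A\<close> and splitting uses up one bad scale at
  every point.  Deciding this piece by piece avoids counting the possible sets of bad scales,
  which would cost a logarithmic factor in the dimension bound.
\<close>

lemma cover_few_bad_scales:
  fixes N :: "'a::euclidean_space set" and K :: nat
  assumes "2 \<le> K"
    and K: "\<And>(A::'a set) D. \<lbrakk>0 < D; bounded A; diameter A \<le> D\<rbrakk> \<Longrightarrow>
     \<exists>\<U>. finite \<U> \<and> card \<U> \<le> K \<and> A = \<Union>\<U> \<and> (\<forall>U\<in>\<U>. bounded U \<and> diameter U \<le> D / 2)"
    and "k \<le> n" "A \<subseteq> N" "bounded A" "diameter A \<le> (1/2)^k / 2"
    and "\<And>x. x \<in> A \<Longrightarrow> card {j \<in> {k..<n}. bad_scale N x j} \<le> m"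
  shows "\<exists>\<U>. finite \<U> \<and> card \<U> \<le> K ^ m \<and> A \<subseteq> \<Union>\<U> \<and>
     (\<forall>U\<in>\<U>. bounded U \<and> diameter U \<le> (1/2)^n / 2)"
  using assms(3-7)
\<comment> \<open>The induction descends from \<open>n\<close>, where \<open>A\<close> covers
  itself. Both \<open>A\<close> and \<open>m\<close> vary, since splitting passes to smaller sets
  with a smaller budget of bad scales.\<close>
proof (induction k arbitrary: A m rule: inc_induct)
  case base
  then show ?case using \<open>2 \<le> K\<close> by (intro exI[of _ "{A}"]) auto
next
  case (step k)
  have split: "{j \<in> {k..<n}. bad_scale N x j} =
      (if bad_scale N x k then insert k {j \<in> {Suc k..<n}. bad_scale N x j}
       else {j \<in> {Suc k..<n}. bad_scale N x j})" for x
    using step.hyps by (auto simp: less_Suc_eq_le Suc_le_eq order_le_less)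
  consider "A = {}" | x where "x \<in> A" "\<not> bad_scale N x k"
    | "A \<noteq> {}" "\<And>x. x \<in> A \<Longrightarrow> bad_scale N x k" by blast
  then show ?case
  proof cases
    case 1
    then show ?thesis by (intro exI[of _ "{}"]) auto
  next
    case 2
    \<comment> \<open>The diameter of \<open>A\<close> is at most half the radius, so the ball about
      the one good point \<open>x\<close> contains all of \<open>A\<close>, and the small hull at
      \<open>x\<close> controls the whole set.\<close>
    have "A \<subseteq> N \<inter> ball x ((1/2)^k)"
    proof
      fix y assume "y \<in> A"
      then have "dist x y \<le> (1/2)^k / 2"
        using diameter_bounded_bound[of A x y] 2 step.prems by simp
      also have "\<dots> < (1/2)^k" by simp
      finally show "y \<in> N \<inter> ball x ((1/2)^k)" using \<open>y \<in> A\<close> step.prems by auto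
    qed
    also have "\<dots> \<subseteq> convex hull (N \<inter> ball x ((1/2)^k))" by (rule hull_subset)
    finally have "diameter A \<le> diameter (convex hull (N \<inter> ball x ((1/2)^k)))"
      by (rule diameter_subset) (auto intro: bounded_convex_hull bounded_Int)
    also have "\<dots> \<le> (1/2)^Suc k / 2"
      using 2 by (simp add: bad_scale_def)
    finally have "diameter A \<le> (1/2)^Suc k / 2" .
    moreover have "card {j \<in> {Suc k..<n}. bad_scale N y j} \<le> m" if "y \<in> A" for y
      using step.prems(4)[OF that] by (rule order_trans[rotated]) (intro card_mono; auto)
    ultimately show ?thesis using step.prems by (intro step.IH) auto
  next
    case 3
    \<comment> \<open>Scale \<open>k\<close> is bad at every point of \<open>A\<close>, so one unit
      of the budget is spent; this pays for the factor \<open>K\<close> from splitting.\<close>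
    have card: "Suc (card {j \<in> {Suc k..<n}. bad_scale N y j}) \<le> m" if "y \<in> A" for y
      using step.prems(4)[OF that] 3(2)[OF that] unfolding split by simp
    with 3(1) obtain m' where m: "m = Suc m'" by (cases m) auto
    obtain \<V> where \<V>: "finite \<V>" "card \<V> \<le> K" "A = \<Union>\<V>"
        "\<And>V. V \<in> \<V> \<Longrightarrow> bounded V \<and> diameter V \<le> (1/2)^k / 2 / 2"
      using K[of "(1/2)^k / 2" A] step.prems by auto
    have "\<exists>\<U>. finite \<U> \<and> card \<U> \<le> K ^ m' \<and> V \<subseteq> \<Union>\<U> \<and>
        (\<forall>U\<in>\<U>. bounded U \<and> diameter U \<le> (1/2)^n / 2)" if "V \<in> \<V>" for V
    proof (rule step.IH)
      show "V \<subseteq> N" "bounded V" "diameter V \<le> (1/2)^Suc k / 2"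
        using that \<V>(3) \<V>(4)[OF that] step.prems by auto
      show "card {j \<in> {Suc k..<n}. bad_scale N x j} \<le> m'" if "x \<in> V" for x
        using card[of x] \<V>(3) that \<open>V \<in> \<V>\<close> m by auto
    qed
    then obtain \<U> where \<U>: "\<And>V. V \<in> \<V> \<Longrightarrow> finite (\<U> V) \<and> card (\<U> V) \<le> K ^ m' \<and> V \<subseteq> \<Union>(\<U> V) \<and>
        (\<forall>U\<in>\<U> V. bounded U \<and> diameter U \<le> (1/2)^n / 2)"
      by metis
    have "card (\<Union>(\<U> ` \<V>)) \<le> (\<Sum>V\<in>\<V>. card (\<U> V))" by (rule card_UN_le[OF \<V>(1)])
    also have "\<dots> \<le> card \<V> * K ^ m'" using \<U> sum_bounded_above[of \<V> "\<lambda>V. card (\<U> V)" "K ^ m'"] by simp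
    also have "\<dots> \<le> K ^ m" using \<V>(2) by (simp add: m)
    finally have "card (\<Union>(\<U> ` \<V>)) \<le> K ^ m" .
    moreover have "A \<subseteq> \<Union>(\<Union>(\<U> ` \<V>))"
    proof
      fix x assume "x \<in> A"
      then obtain V where "V \<in> \<V>" "x \<in> V" using \<V>(3) by auto
      moreover from \<U>[OF this(1)] have "V \<subseteq> \<Union>(\<U> V)" by simp
      ultimately show "x \<in> \<Union>(\<Union>(\<U> ` \<V>))" by (simp add: subset_iff) metis
    qed
    moreover have "finite (\<Union>(\<U> ` \<V>))" using \<U> \<V>(1) by simp
    moreover have "\<forall>U\<in>\<Union>(\<U> ` \<V>). bounded U \<and> diameter U \<le> (1/2)^n / 2" using \<U> by simp
    ultimately show ?thesis by metis
  qed
qed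

section \<open>Bad scales and the integral of the squared density\<close>

lemma diameter_hull_mono:
  fixes N :: "'a::euclidean_space set"
  assumes "r \<le> t"
  shows "diameter (convex hull (N \<inter> ball x r)) \<le> diameter (convex hull (N \<inter> ball x t))"
proof (rule diameter_subset)
  show "convex hull (N \<inter> ball x r) \<subseteq> convex hull (N \<inter> ball x t)"
    by (rule hull_mono) (use assms in auto)
qed (auto intro: bounded_convex_hull bounded_Int)

lemma diameter_hull_nonneg:
  fixes N :: "'a::euclidean_space set"
  shows "0 \<le> diameter (convex hull (N \<inter> ball x r))"
  by (intro diameter_ge_0 bounded_convex_hull bounded_Int) auto

lemma convex_density_sq_integrable:
  fixes N :: "'a::euclidean_space set"
  assumes "0 < r"
  shows "(\<lambda>t. (convex_density N x t)\<^sup>2 / t) integrable_on {r..b}"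
proof -
  let ?I = "\<lambda>t. diameter (convex hull (N \<inter> ball x t))"
  have "(\<lambda>t. 1 / (4 * t^3) :: real) integrable_on {r..b}"
    by (rule integrable_continuous_real) (use assms in \<open>auto intro!: continuous_intros\<close>)
  then have "(\<lambda>t. (?I t)\<^sup>2 * (1 / (4 * t^3))) integrable_on {r..b}"
  proof (cases "r \<le> b")
    case True
    with \<open>(\<lambda>t. 1 / (4 * t^3)) integrable_on {r..b}\<close> show ?thesis
      by (rule second_mean_value_theorem_full[where g = "\<lambda>t. (?I t)\<^sup>2"])
        (auto intro!: power_mono diameter_hull_mono diameter_hull_nonneg has_integral_integrable)
  qed (simp add: integrable_on_empty)
  then show ?thesis
    by (simp add: convex_density_def power_divide power2_eq_square power3_eq_cube mult.assoc)
qed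

text \<open>The dyadic intervals from \<open>(1/2)^k\<close> to \<open>2 * (1/2)^k\<close>, for
  \<open>k\<close> from 1 to \<open>n\<close>, tile the range of integration, and each bad
  \<open>k\<close> contributes at least 1/512 on its own interval.\<close>

lemma card_bad_scales_le_integral:
  fixes N :: "'a::euclidean_space set"
  shows "real (card {k \<in> {1..<Suc n}. bad_scale N x k}) \<le>
    512 * integral {(1/2)^n..1} (\<lambda>t. (convex_density N x t)\<^sup>2 / t)"
proof (induction n)
  case 0
  then show ?case by simp
next
  case (Suc n)
  let ?f = "\<lambda>t. (convex_density N x t)\<^sup>2 / t"
  let ?r = "(1/2)^Suc n :: real"
  have le: "?r \<le> 2 * ?r" by simp
  have nonneg: "0 \<le> integral {?r..2 * ?r} ?f"
  proof (rule integral_nonneg)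
    show "?f integrable_on {?r..2 * ?r}" by (rule convex_density_sq_integrable) simp
    fix t assume "t \<in> {?r..2 * ?r}"
    moreover have "0 < ?r" by simp
    ultimately have "0 < t" unfolding atLeastAtMost_iff by linarith
    then show "0 \<le> ?f t" by simp
  qed
  \<comment> \<open>For \<open>t\<close> between \<open>?r\<close> and \<open>2 * ?r\<close> the
    hull diameter is at least \<open>?r / 4\<close> by monotonicity, so the density is at least
    1/16. Its square over \<open>t\<close> is at least \<open>1 / (512 * ?r)\<close>, and the
    interval has length \<open>?r\<close>.\<close>
  have bad: "1 \<le> 512 * integral {?r..2 * ?r} ?f" if "bad_scale N x (Suc n)"
  proof -
    have "integral {?r..2 * ?r} (\<lambda>t. 1 / (512 * ?r)) \<le> integral {?r..2 * ?r} ?f"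
    proof (rule integral_le)
      show "?f integrable_on {?r..2 * ?r}" by (rule convex_density_sq_integrable) simp
      fix t assume "t \<in> {?r..2 * ?r}"
      moreover have r: "0 < ?r" by simp
      ultimately have t: "?r \<le> t" "t \<le> 2 * ?r" "0 < t"
        unfolding atLeastAtMost_iff by linarith+
      have "?r / 4 \<le> diameter (convex hull (N \<inter> ball x t))"
        using that diameter_hull_mono[OF t(1), of N x] by (simp add: bad_scale_def)
      then have "?r / 4 / (2 * t) \<le> convex_density N x t"
        unfolding convex_density_def using t by (intro divide_right_mono) auto
      moreover have "1 / 16 \<le> ?r / 4 / (2 * t)" using t by (simp add: field_simps)
      ultimately have "(1/16)\<^sup>2 \<le> (convex_density N x t)\<^sup>2" by (intro power_mono) auto
      then have "(1/16)\<^sup>2 / t \<le> ?f t" using t by (intro divide_right_mono) auto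
      moreover have "1 / (512 * ?r) \<le> (1/16)\<^sup>2 / t" using t r by (simp add: field_simps)
      ultimately show "1 / (512 * ?r) \<le> ?f t" by linarith
    qed auto
    moreover have "integral {?r..2 * ?r} (\<lambda>t. 1 / (512 * ?r)) = 1 / 512"
      using le by simp
    ultimately show ?thesis by linarith
  qed
  have split: "{k \<in> {1..<Suc (Suc n)}. bad_scale N x k} =
      (if bad_scale N x (Suc n) then insert (Suc n) {k \<in> {1..<Suc n}. bad_scale N x k}
       else {k \<in> {1..<Suc n}. bad_scale N x k})"
    by (auto simp: less_Suc_eq)
  have "integral {?r..2 * ?r} ?f + integral {2 * ?r..1} ?f = integral {?r..1} ?f"
    by (rule Henstock_Kurzweil_Integration.integral_combine)
       (use convex_density_sq_integrable[of ?r N x 1] in \<open>auto simp: power_le_one\<close>)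
  moreover have "2 * ?r = (1/2)^n" by simp
  ultimately have "512 * integral {?r..1} ?f = 512 * integral {?r..2 * ?r} ?f + 512 * integral {(1/2)^n..1} ?f"
    by simp
  then show ?case
    using Suc.IH nonneg bad unfolding split by (cases "bad_scale N x (Suc n)") auto
qed

text \<open>A lower limit below \<open>a\<close> gives arbitrarily small radii \<open>r\<close> at
  which the integral is less than \<open>a\<close> times \<open>- ln r\<close>. Rounding
  \<open>r\<close> up to a power of 1/2 only shrinks the integral, and the count of bad scales
  follows.\<close>

lemma frequently_few_bad_scales:
  fixes N :: "'a::euclidean_space set"
  assumes lim: "Liminf (at_right 0)
        (\<lambda>r. ereal (integral {r..1} (\<lambda>t. (convex_density N x t)\<^sup>2 / t) / (- ln r))) < ereal a"
  shows "\<exists>n\<ge>n0. real (card {k \<in> {1..<n}. bad_scale N x k}) \<le> 512 * a * (real n + 1)"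
proof -
  let ?f = "\<lambda>t. (convex_density N x t)\<^sup>2 / t"
  have "\<exists>r. 0 < r \<and> r < (1/2)^Suc n0 \<and> integral {r..1} ?f / (- ln r) < a"
  proof (rule ccontr)
    assume *: "\<not> ?thesis"
    have "eventually (\<lambda>r. r \<in> {0<..<(1/2)^Suc n0}) (at_right (0::real))"
      by (rule eventually_at_right_real) simp
    then have "eventually (\<lambda>r. ereal a \<le> ereal (integral {r..1} ?f / (- ln r))) (at_right 0)"
    proof eventually_elim
      case (elim r)
      then have "\<not> integral {r..1} ?f / (- ln r) < a" using * by auto
      then show ?case by (simp only: not_less ereal_less_eq)
    qed
    then have "ereal a \<le> Liminf (at_right 0) (\<lambda>r. ereal (integral {r..1} ?f / (- ln r)))"
      by (rule Liminf_bounded)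
    with lim show False by simp
  qed
  then obtain r where r: "0 < r" "r < (1/2)^Suc n0" "integral {r..1} ?f / (- ln r) < a" by blast
  have "(1/2)^Suc n0 \<le> (1::real)" by (rule power_le_one) auto
  with r have "r < 1" by linarith
  \<comment> \<open>This is the \<open>n\<close> with \<open>(1/2)^Suc n < r \<le> (1/2)^n\<close>;
    since \<open>r\<close> is below \<open>(1/2)^Suc n0\<close>, it exceeds
    \<open>n0\<close>.\<close>
  define n where "n = nat \<lfloor>log 2 (1/r)\<rfloor>"
  have log: "0 \<le> log 2 (1/r)" using r \<open>r < 1\<close> by simp
  have n: "real n \<le> log 2 (1/r)" "log 2 (1/r) < real n + 1"
    using log by (auto simp: n_def of_nat_nat)
  have "2 powr real n \<le> 1/r" "1/r < 2 powr (real n + 1)"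
    using n r by (simp_all add: le_log_iff log_less_iff)
  then have n': "r \<le> (1/2)^n" "(1/2)^Suc n < r"
    using r by (simp_all add: powr_realpow powr_add field_simps power_one_over)
  have "(1/2::real)^Suc n < (1/2)^Suc n0" using n' r by linarith
  then have "n0 < n" by (subst (asm) power_strict_decreasing_iff) auto
  have "- ln r = ln (1/r)" using r(1) by (simp add: ln_div)
  also have "\<dots> \<le> ln (2 powr (real n + 1))"
    using \<open>1/r < 2 powr (real n + 1)\<close> r(1) by (subst ln_le_cancel_iff) auto
  \<comment> \<open>The factor \<open>ln 2\<close> is bounded by 1, which affects only the
    constant.\<close>
  also have "\<dots> \<le> (real n + 1)"
    using ln_2_less_1 by (simp add: ln_powr mult_left_le)
  finally have ln: "- ln r \<le> real n + 1" .
  have neg: "ln r < 0" using r \<open>r < 1\<close> by simp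
  have fnonneg: "0 \<le> ?f t" if "r \<le> t" for t using that r by simp
  have "0 \<le> integral {r..1} ?f"
    by (rule integral_nonneg[OF convex_density_sq_integrable[OF r(1)]]) (use fnonneg in auto)
  then have "0 \<le> integral {r..1} ?f / (- ln r)" using neg by (intro divide_nonneg_pos) auto
  with r have "0 < a" by linarith
  have "integral {(1/2)^n..1} ?f \<le> integral {r..1} ?f"
    by (rule integral_subset_le)
      (use n' r fnonneg in \<open>auto intro: convex_density_sq_integrable\<close>)
  also have "\<dots> \<le> a * (- ln r)"
    using r(3) neg by (simp add: field_simps)
  also have "\<dots> \<le> a * (real n + 1)" using ln \<open>0 < a\<close> by (intro mult_left_mono) auto
  finally have I: "integral {(1/2)^n..1} ?f \<le> a * (real n + 1)" .
  have "card {k \<in> {1..<n}. bad_scale N x k} \<le> card {k \<in> {1..<Suc n}. bad_scale N x k}"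
    by (rule card_mono) auto
  then have "real (card {k \<in> {1..<n}. bad_scale N x k}) \<le> 512 * a * (real n + 1)"
    using card_bad_scales_le_integral[of n N x] I by linarith
  with \<open>n0 < n\<close> show ?thesis by (intro exI[of _ n]) auto
qed

section \<open>The dimension bound\<close>

text \<open>Every point of \<open>P\<close> lies in infinitely many of the sets \<open>A n\<close>
  of points with few bad scales below \<open>n\<close>, and their contents are dominated by a
  geometric series. Hence the content of \<open>P\<close> is below every tail of a convergent
  series.\<close>

lemma hausdorff_content_few_bad_scales_zero:
  fixes N :: "'a::euclidean_space set" and K :: nat
  assumes "2 \<le> K"
    and K: "\<And>(A::'a set) D. \<lbrakk>0 < D; bounded A; diameter A \<le> D\<rbrakk> \<Longrightarrow>
     \<exists>\<U>. finite \<U> \<and> card \<U> \<le> K \<and> A = \<Union>\<U> \<and> (\<forall>U\<in>\<U>. bounded U \<and> diameter U \<le> D / 2)"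
    and "P \<subseteq> N" "bounded P" "diameter P \<le> 1 / 4"
    and few: "\<And>x n0. x \<in> P \<Longrightarrow> \<exists>n\<ge>n0. real (card {k \<in> {1..<n}. bad_scale N x k}) \<le> b * (real n + 1)"
    and "0 \<le> b" "b * log 2 K < s" "0 < \<delta>"
  shows "hausdorff_content s \<delta> P = 0"
proof -
  define A where "A n = {x\<in>P. real (card {k \<in> {1..<n}. bad_scale N x k}) \<le> b * (real n + 1)}" for n
  \<comment> \<open>Each level multiplies the number of covering sets by about
    \<open>K powr b\<close> and the gauge of each by \<open>(1/2) powr s\<close>. The hypothesis
    \<open>b * log 2 K < s\<close> says exactly that this product is below 1.\<close>
  define q where "q = K powr b * (1/2) powr s"
  have "0 \<le> b * log 2 K" using \<open>0 \<le> b\<close> \<open>2 \<le> K\<close> by simp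
  with assms have "0 < s" by linarith
  have "K powr b = 2 powr (b * log 2 K)"
    using \<open>2 \<le> K\<close> by (subst mult.commute, subst powr_powr[symmetric]) simp
  also have "\<dots> < 2 powr s" using assms by simp
  finally have q: "0 < q" "q < 1"
    using \<open>2 \<le> K\<close> by (auto simp: q_def powr_divide field_simps)
  have A: "hausdorff_content s \<delta> (A n) \<le> ennreal (K powr b * q ^ n)" if "1 \<le> n" "(1/2)^n \<le> \<delta>" for n
  proof -
    define m where "m = nat \<lfloor>b * (real n + 1)\<rfloor>"
    have m: "real m \<le> b * (real n + 1)" using \<open>0 \<le> b\<close> by (simp add: m_def of_nat_nat)
    have "\<exists>\<U>. finite \<U> \<and> card \<U> \<le> K ^ m \<and> A n \<subseteq> \<Union>\<U> \<and> (\<forall>U\<in>\<U>. bounded U \<and> diameter U \<le> (1/2)^n / 2)"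
    \<comment> \<open>The covering starts at level 1, where the required diameter bound
      \<open>(1/2)^1 / 2\<close> is the assumed 1/4.\<close>
    proof (rule cover_few_bad_scales[OF \<open>2 \<le> K\<close> K \<open>1 \<le> n\<close>])
      show "A n \<subseteq> N" "bounded (A n)"
        using assms by (auto simp: A_def intro: bounded_subset)
      have "diameter (A n) \<le> diameter P"
        by (rule diameter_subset) (use assms in \<open>auto simp: A_def\<close>)
      then show "diameter (A n) \<le> (1/2)^1 / 2" using assms by simp
      show "card {j \<in> {1..<n}. bad_scale N x j} \<le> m" if "x \<in> A n" for x
        using that by (auto simp: A_def m_def le_nat_floor)
    qed
    then obtain \<U> where \<U>: "finite \<U>" "card \<U> \<le> K ^ m" "A n \<subseteq> \<Union>\<U>"
       "\<And>U. U \<in> \<U> \<Longrightarrow> bounded U \<and> diameter U \<le> (1/2)^n / 2" by blast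
    have "hausdorff_content s \<delta> (A n) \<le> ennreal (real (card \<U>) * ((1/2)^n) powr s)"
    proof (rule hausdorff_content_finite_cover[OF \<open>0 < s\<close> _ that(2) \<U>(1,3)])
      fix U assume "U \<in> \<U>"
      moreover have "(1/2::real)^n / 2 \<le> (1/2)^n" by simp
      ultimately show "bounded U \<and> diameter U \<le> (1/2)^n" using \<U>(4) by (meson order_trans)
    qed simp
    also have "\<dots> \<le> ennreal (K powr b * q ^ n)"
    proof (rule ennreal_leI)
      have "real (card \<U>) \<le> real K ^ m" using \<U>(2) by (metis of_nat_le_iff of_nat_power)
      also have "\<dots> = K powr real m" using \<open>2 \<le> K\<close> by (simp add: powr_realpow)
      also have "\<dots> \<le> K powr (b * (real n + 1))" using m \<open>2 \<le> K\<close> by (intro powr_mono) auto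
      also have "\<dots> = K powr b * (K powr b) ^ n"
        using \<open>2 \<le> K\<close> by (simp add: powr_add powr_power distrib_left mult.commute)
      finally have "real (card \<U>) * ((1/2)^n) powr s \<le> K powr b * (K powr b) ^ n * ((1/2)^n) powr s"
        by (rule mult_right_mono) simp
      moreover have "((1/2)^n) powr s = ((1/2::real) powr s) ^ n"
        by (simp add: powr_power powr_realpow[symmetric] powr_powr mult.commute)
      ultimately show "real (card \<U>) * ((1/2)^n) powr s \<le> K powr b * q ^ n"
        by (simp add: q_def power_mult_distrib mult.assoc)
    qed
    finally show ?thesis .
  qed
  obtain M where M: "(1/2)^M < \<delta>" using real_arch_pow_inv[of \<delta> "1/2"] \<open>0 < \<delta>\<close> by auto
  have bound: "hausdorff_content s \<delta> P \<le> ennreal (K powr b * q ^ n0 / (1 - q))" if "Suc M \<le> n0" for n0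
  proof -
    have "P \<subseteq> (\<Union>i. A (i + n0))"
    proof
      fix x assume "x \<in> P"
      then obtain n where "n \<ge> n0" "x \<in> A n" using few[of x n0] by (auto simp: A_def)
      then show "x \<in> (\<Union>i. A (i + n0))" by (intro UN_I[of "n - n0"]) auto
    qed
    then have "hausdorff_content s \<delta> P \<le> hausdorff_content s \<delta> (\<Union>i. A (i + n0))"
      by (rule hausdorff_content_mono)
    also have "\<dots> \<le> (\<Sum>i. hausdorff_content s \<delta> (A (i + n0)))"
      by (rule hausdorff_content_countable_subadditive)
    also have "\<dots> \<le> (\<Sum>i. ennreal (K powr b * q ^ (i + n0)))"
    proof (intro suminf_le A)
      fix i
      have "(1/2::real)^(i + n0) \<le> (1/2)^M" using that by (intro power_decreasing) auto
      then show "(1/2)^(i + n0) \<le> \<delta>" using M by linarith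
    qed (use that in auto)
    also have "\<dots> = ennreal (K powr b * q ^ n0 / (1 - q))"
    proof (rule suminf_ennreal_eq)
      have "(\<lambda>i. K powr b * q ^ n0 * q ^ i) sums (K powr b * q ^ n0 * (1 / (1 - q)))"
        by (intro sums_mult geometric_sums) (use q in auto)
      then show "(\<lambda>i. K powr b * q ^ (i + n0)) sums (K powr b * q ^ n0 / (1 - q))"
        by (simp add: power_add mult_ac)
    qed (use q in auto)
    finally show ?thesis .
  qed
  have "(\<lambda>n. K powr b * q ^ n / (1 - q)) \<longlonglongrightarrow> K powr b * 0 / (1 - q)"
    by (intro tendsto_intros LIMSEQ_power_zero) (use q in auto)
  then have "(\<lambda>n. ennreal (K powr b * q ^ n / (1 - q))) \<longlonglongrightarrow> ennreal 0"
    by (intro tendsto_ennrealI) simp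
  then have "hausdorff_content s \<delta> P \<le> ennreal 0"
    by (rule LIMSEQ_le_const) (use bound in auto)
  then show ?thesis by simp
qed

text \<open>This reduces an arbitrary, possibly unbounded \<open>N\<close> to countably many pieces
  small enough to start the covering; balls about a countable dense set serve.\<close>

lemma ex_small_pieces:
  fixes e :: real
  assumes "0 < e"
  shows "\<exists>B :: nat \<Rightarrow> 'a::euclidean_space set. (\<Union>i. B i) = UNIV \<and> (\<forall>i. bounded (B i) \<and> diameter (B i) \<le> e)"
proof -
  obtain D :: "'a set" where D: "countable D" "\<And>X. open X \<Longrightarrow> X \<noteq> {} \<Longrightarrow> \<exists>d\<in>D. d \<in> X"
    using countable_dense_exists by metis
  define B where "B i = ball (from_nat_into D i) (e/2)" for i
  have "x \<in> (\<Union>i. B i)" for x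
  proof -
    obtain d where "d \<in> D" "d \<in> ball x (e/2)" using D(2)[of "ball x (e/2)"] assms by auto
    moreover obtain i where "from_nat_into D i = d"
      using from_nat_into_surj[OF D(1)] \<open>d \<in> D\<close> by metis
    ultimately show ?thesis by (auto simp: B_def dist_commute)
  qed
  then show ?thesis using assms by (intro exI[of _ B]) (auto simp: B_def)
qed

theorem theorem7:
  shows "\<exists>c::real. \<forall>(N :: (real ^ 'n) set) (d0 :: real).
    (\<forall>x\<in>N. Liminf (at_right 0)
        (\<lambda>r. ereal (integral {r..1} (\<lambda>t. (convex_density N x t)\<^sup>2 / t) / (- ln r)))
      \<le> ereal (d0\<^sup>2))
    \<longrightarrow> hausdorff_dim N \<le> ereal (c * d0\<^sup>2)"
proof -
  obtain K :: nat where "2 \<le> K" and K: "\<And>(A::(real ^ 'n) set) D. \<lbrakk>0 < D; bounded A; diameter A \<le> D\<rbrakk> \<Longrightarrow>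
     \<exists>\<U>. finite \<U> \<and> card \<U> \<le> K \<and> A = \<Union>\<U> \<and> (\<forall>U\<in>\<U>. bounded U \<and> diameter U \<le> D / 2)"
    using halving_cover by metis
  \<comment> \<open>The factor 512 is the cost of a bad scale in the integral and
    \<open>log 2 K\<close> its cost in the cover. Through \<open>K\<close> the constant depends on
    the ambient space, but on neither \<open>N\<close> nor \<open>d0\<close>.\<close>
  define c where "c = 512 * log 2 K"
  have "0 < c" using \<open>2 \<le> K\<close> by (simp add: c_def)
  show ?thesis
  proof (intro exI[of _ c] allI impI)
    fix N :: "(real ^ 'n) set" and d0 :: real
    assume lim: "\<forall>x\<in>N. Liminf (at_right 0)
        (\<lambda>r. ereal (integral {r..1} (\<lambda>t. (convex_density N x t)\<^sup>2 / t) / (- ln r))) \<le> ereal (d0\<^sup>2)"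
    show "hausdorff_dim N \<le> ereal (c * d0\<^sup>2)"
    proof (rule hausdorff_dim_le)
      show "0 \<le> c * d0\<^sup>2" using \<open>0 < c\<close> by simp
      fix s \<delta> :: real assume s: "c * d0\<^sup>2 < s" and "0 < \<delta>"
      then have "d0\<^sup>2 < s / c" using \<open>0 < c\<close> by (simp add: field_simps)
      \<comment> \<open>The slack turns the bound on the lower limit into a strict one, while
        \<open>a < s / c\<close> keeps \<open>512 * a * log 2 K\<close> below
        \<open>s\<close>.\<close>
      then obtain a where a: "d0\<^sup>2 < a" "a < s / c" using dense by blast
      have "0 \<le> a" using a(1) zero_le_power2[of d0] by linarith
      obtain B :: "nat \<Rightarrow> (real ^ 'n) set" where B: "(\<Union>i. B i) = UNIV"
          "\<And>i. bounded (B i)" "\<And>i. diameter (B i) \<le> 1/4"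
        using ex_small_pieces[of "1/4"] by auto
      have "hausdorff_content s \<delta> (N \<inter> B i) = 0" for i
      proof (rule hausdorff_content_few_bad_scales_zero[OF \<open>2 \<le> K\<close> K])
        have "diameter (N \<inter> B i) \<le> diameter (B i)"
          by (rule diameter_subset) (use B in auto)
        then show "diameter (N \<inter> B i) \<le> 1/4" using B(3)[of i] by linarith
        show "bounded (N \<inter> B i)" using B by (simp add: bounded_Int)
        fix x n0 assume "x \<in> N \<inter> B i"
        then show "\<exists>n\<ge>n0. real (card {k \<in> {1..<n}. bad_scale N x k}) \<le> 512 * a * (real n + 1)"
          using lim a(1) by (intro frequently_few_bad_scales) (auto intro: le_less_trans)
      next
        show "512 * a * log 2 K < s" using a(2) \<open>0 < c\<close> by (simp add: c_def field_simps)
      qed (use \<open>0 \<le> a\<close> \<open>0 < \<delta>\<close> in auto)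
      then have "(\<Sum>i. hausdorff_content s \<delta> (N \<inter> B i)) = 0" by simp
      moreover have "N = (\<Union>i. N \<inter> B i)" using B(1) by auto
      ultimately show "hausdorff_content s \<delta> N = 0"
        using hausdorff_content_countable_subadditive[of s \<delta> "\<lambda>i. N \<inter> B i"] by simp
    qed
  qed
qed

end
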